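(* Let $\langle X,d\rangle$ be a Bourbaki-complete metric space. Then $X$ is uniformly star superparacompact if and only if for every $\varepsilon>0$ there exists $\delta>0$ such that for every nonempty closed subset $A$ of $X$, if $\overline{f_c}(A)<\delta$, then $\eta(A)<\varepsilon$.
   Context: Metric spaces are assumed to contain at least two points. For $x\in X$, $\varepsilon>0$ and $m\in\mathbb N$ ($m\ge 1$), $S^m_d(x,\varepsilon)$ is the set of all $y\in X$ for which there is a sequence $x=x_0,x_1,\dots,x_m=y$ in $X$ with $d(x_{i-1},x_i)<\varepsilon$ for $i=1,\dots,m$; and $S^\infty_d(x,\varepsilon)=\bigcup_{m\in\mathbb N}S^m_d(x,\varepsilon)$. Define $f_c(x)=\sup\{\varepsilon>0: S^\infty_d(x,\varepsilon)\text{ is compact}\}\in[0,\infty]$ if $S^\infty_d(x,\varepsilon)$ is compact for some $\varepsilon>0$, and $f_c(x)=0$ otherwise. For nonempty $A\subseteq X$, $\overline{f_c}(A)=\sup\{f_c(a):a\in A\}$ and $\eta(A)=\inf\{\varepsilon>0: A\subseteq\bigcup_{i=1}^k S^m_d(x_i,\varepsilon)\text{ for some } m\in\mathbb N \text{ and finitely many } x_1,\dots,x_k\in X\}\in[0,\infty]$ (with $\inf\emptyset=\infty$). A sequence $\langle x_n\rangle$ is Bourbaki-Cauchy in $X$ if for every $\varepsilon>0$ there exist $m,n_0\in\mathbb N$ and $p\in X$ with $x_n\in S^m_d(p,\varepsilon)$ for every $n\ge n_0$; $X$ is Bourbaki-complete if every Bourbaki-Cauchy sequence in $X$ has a cluster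 point in $X$. $X$ is uniformly star superparacompact if for each open cover $\mathcal V$ of $X$ there exist $\mu>0$ and an open cover $\mathcal U$ of $X$ refining $\mathcal V$ (each member of $\mathcal U$ is contained in some member of $\mathcal V$) such that for each $x\in X$, $S^\infty_d(x,\mu)$ intersects at most finitely many members of $\mathcal U$. *)

theory Defs
  imports "HOL-Analysis.Analysis"
begin

context Metric_space
begin

definition chain_ball :: "nat \<Rightarrow> 'a \<Rightarrow> real \<Rightarrow> 'a set" where
  "chain_ball m x \<epsilon> = {y. \<exists>c. (\<forall>i\<le>m. c i \<in> M) \<and> c 0 = x \<and> c m = y \<and>
                             (\<forall>i\<in>{1..m}. d (c (i - 1)) (c i) < \<epsilon>)}"

definition chain_component :: "'a \<Rightarrow> real \<Rightarrow> 'a set" where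
  "chain_component x \<epsilon> = (\<Union>m\<in>{1..}. chain_ball m x \<epsilon>)"

definition fc :: "'a \<Rightarrow> ennreal" where
  "fc x = (if \<exists>\<epsilon>>0. compactin mtopology (chain_component x \<epsilon>)
           then Sup {ennreal \<epsilon> |\<epsilon>. \<epsilon> > 0 \<and> compactin mtopology (chain_component x \<epsilon>)}
           else 0)"

definition fc_sup :: "'a set \<Rightarrow> ennreal" where
  "fc_sup A = Sup (fc ` A)"

(* The infimum of the empty set in ennreal is infinity. *)
definition eta :: "'a set \<Rightarrow> ennreal" where
  "eta A = Inf {ennreal \<epsilon> |\<epsilon>. \<epsilon> > 0 \<and>
                (\<exists>m\<ge>1. \<exists>F. finite F \<and> F \<subseteq> M \<and> A \<subseteq> (\<Union>x\<in>F. chain_ball m x \<epsilon>))}"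

definition Bourbaki_Cauchy :: "(nat \<Rightarrow> 'a) \<Rightarrow> bool" where
  "Bourbaki_Cauchy \<sigma> \<longleftrightarrow> range \<sigma> \<subseteq> M \<and>
     (\<forall>\<epsilon>>0. \<exists>m\<ge>1. \<exists>n0. \<exists>p\<in>M. \<forall>n\<ge>n0. \<sigma> n \<in> chain_ball m p \<epsilon>)"

definition cluster_point :: "(nat \<Rightarrow> 'a) \<Rightarrow> 'a \<Rightarrow> bool" where
  "cluster_point \<sigma> p \<longleftrightarrow> p \<in> M \<and>
     (\<forall>U. openin mtopology U \<and> p \<in> U \<longrightarrow> (\<exists>\<^sub>F n in sequentially. \<sigma> n \<in> U))"

definition Bourbaki_complete :: bool where
  "Bourbaki_complete \<longleftrightarrow> (\<forall>\<sigma>. Bourbaki_Cauchy \<sigma> \<longrightarrow> (\<exists>p. cluster_point \<sigma> p))"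

definition open_cover :: "'a set set \<Rightarrow> bool" where
  "open_cover \<V> \<longleftrightarrow> (\<forall>V\<in>\<V>. openin mtopology V) \<and> \<Union>\<V> = M"

definition uniformly_star_superparacompact :: bool where
  "uniformly_star_superparacompact \<longleftrightarrow>
     (\<forall>\<V>. open_cover \<V> \<longrightarrow>
        (\<exists>\<mu>>0. \<exists>\<U>. open_cover \<U> \<and> (\<forall>U\<in>\<U>. \<exists>V\<in>\<V>. U \<subseteq> V) \<and>
           (\<forall>x\<in>M. finite {U\<in>\<U>. chain_component x \<mu> \<inter> U \<noteq> {}})))"

end

end

theory Submission
  imports Defs "HOL-Library.Diagonal_Subsequence"
begin

text \<open>
  For \<open>\<mu> > 0\<close> let \<open>N(\<mu>)\<close> be the set of points whose \<open>\<mu>\<close>-chain component is not compact. Chain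
  components at a fixed scale partition \<open>M\<close> into open sets, so \<open>N(\<mu>)\<close> is a union of pieces of a
  clopen partition and hence closed; it decreases with \<open>\<mu>\<close>. The sets \<open>N(\<mu>)\<close> are also, up to
  the choice of strict or weak inequalities, the sublevel sets of \<open>fc\<close>, so the right-hand side of
  the equivalence says that \<open>eta (N(\<mu>))\<close> tends to \<open>0\<close> with \<open>\<mu>\<close> (where \<open>N(\<mu>)\<close> is
  nonempty). Both sides are shown to be equivalent to the following property of the sequence \<open>B n = N(1 / (n + 1))\<close>:

  (P) if \<open>\<sigma> n \<in> B n\<close> for all \<open>n\<close>, then \<open>\<sigma>\<close> has a cluster point.

  From (P), the intersection of all \<open>B n\<close> is compact and every open set containing it contains some
  \<open>B n\<close>. So every open cover has a finite subfamily that covers some \<open>B n\<close>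
  (\<open>finite_cover_of_some_stage\<close>). At scale \<open>1 / (n + 1)\<close> every chain component is then
  finitely covered, because it either is compact or lies in \<open>B n\<close>; this gives uniform star
  superparacompactness. Applied to the cover by small balls it gives the condition on \<open>eta\<close>.

  The condition on \<open>eta\<close> confines a sequence as in (P), from some index on, to finitely many chain
  balls of any prescribed scale. A diagonal argument extracts a Bourbaki-Cauchy subsequence, and
  Bourbaki-completeness gives (P).

  Finally, uniform star superparacompactness makes every locally finite family of points uniformly
  so: for some \<open>\<mu>\<close> every \<open>\<mu>\<close>-component contains only finitely many of them
  (\<open>USP_locally_finite\<close>). If a sequence as in (P) had no cluster point, this would apply first
  to the sequence itself and then to a union of infinite locally finite subsets of the noncompact
  components of its members; the latter is contradictory, because at small scales each of these
  infinite sets lies in a single component (\<open>USP_imp_cluster_point\<close>).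
\<close>

context Metric_space
begin

section \<open>Chain components\<close>

definition link :: "real \<Rightarrow> 'a rel" where
  "link \<epsilon> = {(x, y). x \<in> M \<and> y \<in> M \<and> d x y < \<epsilon>}"

lemma chain_ball_eq_relpow:
  assumes "m \<ge> 1"
  shows "y \<in> chain_ball m x \<epsilon> \<longleftrightarrow> (x, y) \<in> link \<epsilon> ^^ m"
proof
  assume "y \<in> chain_ball m x \<epsilon>"
  then obtain c where c: "\<forall>i\<le>m. c i \<in> M" "c 0 = x" "c m = y"
      "\<forall>i\<in>{1..m}. d (c (i - 1)) (c i) < \<epsilon>"
    by (auto simp: chain_ball_def)
  have "(c i, c (Suc i)) \<in> link \<epsilon>" if "i < m" for i
    using c(1) bspec[OF c(4), of "Suc i"] that by (auto simp: link_def)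
  then show "(x, y) \<in> link \<epsilon> ^^ m"
    using c by (auto simp: relpow_fun_conv)
next
  assume "(x, y) \<in> link \<epsilon> ^^ m"
  then obtain c where c: "c 0 = x" "c m = y" "\<And>i. i < m \<Longrightarrow> (c i, c (Suc i)) \<in> link \<epsilon>"
    by (auto simp: relpow_fun_conv)
  have "c i \<in> M" if "i \<le> m" for i
  proof (cases "i < m")
    case True
    then show ?thesis using c(3) by (auto simp: link_def)
  next
    case False
    then have "i = Suc (m - 1)" "m - 1 < m" using that assms by auto
    then show ?thesis using c(3)[of "m - 1"] by (auto simp: link_def)
  qed
  moreover have "d (c (i - 1)) (c i) < \<epsilon>" if "i \<in> {1..m}" for i
    using c(3)[of "i - 1"] that by (auto simp: link_def)
  ultimately show "y \<in> chain_ball m x \<epsilon>"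
    unfolding chain_ball_def using c(1,2) by blast
qed

lemma chain_component_eq_trancl: "y \<in> chain_component x \<epsilon> \<longleftrightarrow> (x, y) \<in> (link \<epsilon>)\<^sup>+"
proof -
  have "y \<in> chain_component x \<epsilon> \<longleftrightarrow> (\<exists>m\<ge>1. (x, y) \<in> link \<epsilon> ^^ m)"
    by (auto simp: chain_component_def chain_ball_eq_relpow)
  also have "\<dots> \<longleftrightarrow> (x, y) \<in> (link \<epsilon>)\<^sup>+"
    by (simp add: trancl_power Suc_le_eq)
  finally show ?thesis .
qed

lemma chain_ball_mono:
  assumes "\<epsilon> \<le> \<delta>"
  shows "chain_ball m x \<epsilon> \<subseteq> chain_ball m x \<delta>"
  unfolding chain_ball_def using assms by (blast intro: less_le_trans)

lemma mball_subset_chain_ball_1: "mball x \<epsilon> \<subseteq> chain_ball 1 x \<epsilon>"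
  by (auto simp: chain_ball_eq_relpow link_def)

lemma chain_component_refl: "x \<in> M \<Longrightarrow> \<epsilon> > 0 \<Longrightarrow> x \<in> chain_component x \<epsilon>"
  by (auto simp: chain_component_eq_trancl link_def)

lemma chain_component_subset: "chain_component x \<epsilon> \<subseteq> M"
proof
  fix y assume "y \<in> chain_component x \<epsilon>"
  then have "(x, y) \<in> (link \<epsilon>)\<^sup>+" by (simp add: chain_component_eq_trancl)
  then show "y \<in> M" by (induction) (auto simp: link_def)
qed

lemma chain_component_mono: "\<epsilon> \<le> \<delta> \<Longrightarrow> chain_component x \<epsilon> \<subseteq> chain_component x \<delta>"
  using chain_ball_mono by (fastforce simp: chain_component_def)

lemma chain_component_eq:
  assumes "y \<in> chain_component x \<epsilon>"
  shows "chain_component y \<epsilon> = chain_component x \<epsilon>"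
proof -
  have "sym ((link \<epsilon>)\<^sup>+)"
    by (rule sym_trancl) (auto simp: sym_def link_def commute)
  then show ?thesis
    using assms by (auto simp: chain_component_eq_trancl dest: symD intro: trancl_trans)
qed

lemma mball_subset_chain_component: "mball x \<epsilon> \<subseteq> chain_component x \<epsilon>"
  using mball_subset_chain_ball_1 by (force simp: chain_component_def)

text \<open>Stepping by less than \<open>\<epsilon>\<close> never leaves an \<open>\<epsilon>\<close>-component, so membership in a union of
  components is decided on \<open>\<epsilon>\<close>-balls.\<close>

lemma openin_union_of_components:
  assumes "\<epsilon> > 0" "S \<subseteq> M" "\<And>x. x \<in> S \<Longrightarrow> chain_component x \<epsilon> \<subseteq> S"
  shows "openin mtopology S"
  unfolding openin_mtopology
  using assms mball_subset_chain_component by (meson order_trans)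

lemma openin_chain_component: "\<epsilon> > 0 \<Longrightarrow> openin mtopology (chain_component x \<epsilon>)"
  by (rule openin_union_of_components) (auto simp: chain_component_subset chain_component_eq)

lemma closedin_union_of_components:
  assumes "\<epsilon> > 0" "S \<subseteq> M" "\<And>x. x \<in> S \<Longrightarrow> chain_component x \<epsilon> \<subseteq> S"
  shows "closedin mtopology S"
proof -
  have "chain_component x \<epsilon> \<subseteq> M - S" if "x \<in> M - S" for x
  proof
    fix y assume y: "y \<in> chain_component x \<epsilon>"
    have "x \<in> chain_component y \<epsilon>"
      using chain_component_eq[OF y] chain_component_refl[of x \<epsilon>] that assms(1) by auto
    then show "y \<in> M - S"
      using assms(3)[of y] that y chain_component_subset by blast
  qed
  then have "openin mtopology (M - S)"
    by (intro openin_union_of_components[OF assms(1)]) auto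
  then show ?thesis using assms(2) by (simp add: closedin_def)
qed

lemma closedin_chain_component: "\<epsilon> > 0 \<Longrightarrow> closedin mtopology (chain_component x \<epsilon>)"
  by (rule closedin_union_of_components) (auto simp: chain_component_subset chain_component_eq)

section \<open>The points with noncompact chain component\<close>

definition noncompact_part :: "real \<Rightarrow> 'a set" where
  "noncompact_part \<mu> = {x \<in> M. \<not> compactin mtopology (chain_component x \<mu>)}"

lemma compactin_chain_component_antimono:
  assumes "compactin mtopology (chain_component x \<delta>)" "0 < \<epsilon>" "\<epsilon> \<le> \<delta>"
  shows "compactin mtopology (chain_component x \<epsilon>)"
  using closed_compactin[OF assms(1) chain_component_mono closedin_chain_component] assms by auto

lemma noncompact_part_mono:
  assumes "0 < \<epsilon>" "\<epsilon> \<le> \<delta>"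
  shows "noncompact_part \<epsilon> \<subseteq> noncompact_part \<delta>"
  using assms compactin_chain_component_antimono by (auto simp: noncompact_part_def)

lemma component_subset_noncompact_part:
  assumes "x \<in> noncompact_part \<mu>"
  shows "chain_component x \<mu> \<subseteq> noncompact_part \<mu>"
  using assms chain_component_subset chain_component_eq by (fastforce simp: noncompact_part_def)

lemma closedin_noncompact_part: "\<mu> > 0 \<Longrightarrow> closedin mtopology (noncompact_part \<mu>)"
  by (rule closedin_union_of_components)
    (use component_subset_noncompact_part in \<open>auto simp: noncompact_part_def\<close>)

lemma fc_le_if_noncompact:
  assumes "x \<in> noncompact_part \<mu>" "\<mu> > 0"
  shows "fc x \<le> ennreal \<mu>"
proof -
  have "\<epsilon> < \<mu>" if "compactin mtopology (chain_component x \<epsilon>)" for \<epsilon>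
    using compactin_chain_component_antimono[OF that, of \<mu>] assms
    by (force simp: noncompact_part_def)
  then show ?thesis
    unfolding fc_def by (auto intro!: Sup_least ennreal_leI dest: less_imp_le)
qed

lemma noncompact_if_fc_less:
  assumes "x \<in> M" "\<mu> > 0" "fc x < ennreal \<mu>"
  shows "x \<in> noncompact_part \<mu>"
proof (rule ccontr)
  assume "x \<notin> noncompact_part \<mu>"
  then have c: "compactin mtopology (chain_component x \<mu>)"
    using assms(1) by (simp add: noncompact_part_def)
  then have "ennreal \<mu> \<le> Sup {ennreal \<epsilon> |\<epsilon>. \<epsilon> > 0 \<and> compactin mtopology (chain_component x \<epsilon>)}"
    using assms(2) by (intro Sup_upper) blast
  also have "\<dots> = fc x"
    using c assms(2) unfolding fc_def by auto
  finally show False using assms(3) by simp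
qed

section \<open>Cluster points and open covers\<close>

lemma frequently_sequentially_iff_infinite:
  "(\<exists>\<^sub>F n in sequentially. P n) \<longleftrightarrow> infinite {n. P n}"
  by (simp add: frequently_cofinite flip: cofinite_eq_sequentially)

lemma not_cluster_pointD:
  assumes "\<not> cluster_point \<sigma> p" "p \<in> M"
  shows "\<exists>U. openin mtopology U \<and> p \<in> U \<and> finite {n. \<sigma> n \<in> U}"
  using assms by (auto simp: cluster_point_def frequently_sequentially_iff_infinite)

lemma cluster_point_subsequence:
  assumes "strict_mono r" "cluster_point (\<sigma> \<circ> r) p"
  shows "cluster_point \<sigma> p"
  unfolding cluster_point_def
proof (intro conjI allI impI)
  show "p \<in> M" using assms(2) by (simp add: cluster_point_def)
  fix U assume "openin mtopology U \<and> p \<in> U"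
  then have "\<exists>\<^sub>F n in sequentially. \<sigma> (r n) \<in> U"
    using assms(2) by (auto simp: cluster_point_def)
  then show "\<exists>\<^sub>F n in sequentially. \<sigma> n \<in> U"
    using assms(1) unfolding frequently_sequentially
    by (meson order_trans seq_suble)
qed

lemma cluster_point_in_closed:
  assumes "cluster_point \<sigma> p" "closedin mtopology S" "\<forall>\<^sub>F n in sequentially. \<sigma> n \<in> S"
  shows "p \<in> S"
proof (rule ccontr)
  assume "p \<notin> S"
  then have "p \<in> M - S" "openin mtopology (M - S)"
    using assms(1,2) by (auto simp: cluster_point_def closedin_def)
  then have "\<exists>\<^sub>F n in sequentially. \<sigma> n \<in> M - S"
    using assms(1) unfolding cluster_point_def by blast
  then have "\<exists>\<^sub>F n in sequentially. False"
    by (rule frequently_rev_mp) (use assms(3) in \<open>auto elim: eventually_mono\<close>)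
  then show False by simp
qed

text \<open>Points of the intersection of all \<open>B n\<close> can be listed in any order as a sequence with
  \<open>\<sigma> n \<in> B n\<close>, which makes the intersection compact. Points \<open>\<sigma> n\<close> of \<open>B n\<close> outside a finite
  cover of the intersection would cluster inside the intersection, so for some \<open>n\<close> there are none.\<close>

lemma finite_cover_of_some_stage:
  assumes closed: "\<And>n. closedin mtopology (B n)"
    and "decseq B"
    and cluster: "\<And>\<sigma>. (\<And>n. \<sigma> n \<in> B n) \<Longrightarrow> \<exists>p. cluster_point \<sigma> p"
    and "open_cover \<V>"
  shows "\<exists>n \<V>'. finite \<V>' \<and> \<V>' \<subseteq> \<V> \<and> B n \<subseteq> \<Union>\<V>'"
proof -
  define K where "K = (\<Inter>n. B n)"
  have BM: "B n \<subseteq> M" for n using closedin_subset[OF closed] by simp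
  have "compactin mtopology K"
    unfolding compactin_eq_Bolzano_Weierstrass
  proof (intro conjI allI impI)
    show "K \<subseteq> M" using BM by (auto simp: K_def)
    fix T assume T: "T \<subseteq> K \<and> infinite T"
    then obtain y :: "nat \<Rightarrow> 'a" where y: "inj y" "range y \<subseteq> T"
      using infinite_countable_subset by blast
    have yB: "y k \<in> B n" for k n using y T by (auto simp: K_def)
    then obtain p where p: "cluster_point y p" using cluster by blast
    have "p \<in> B n" for n
      by (rule cluster_point_in_closed[OF p closed]) (use yB in auto)
    moreover have "p \<in> mtopology derived_set_of T"
      unfolding in_derived_set_of
    proof (intro conjI allI impI)
      show "p \<in> topspace mtopology" using p by (simp add: cluster_point_def)
      fix U assume "p \<in> U \<and> openin mtopology U"
      then have "infinite {n. y n \<in> U}"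
        using p by (auto simp: cluster_point_def frequently_sequentially_iff_infinite)
      moreover have "finite {n. y n = p}"
        using finite_vimageI[OF _ y(1), of "{p}"] by (simp add: vimage_def)
      ultimately obtain n where "y n \<in> U" "y n \<noteq> p"
        by (metis (mono_tags, lifting) finite_subset mem_Collect_eq subsetI)
      then show "\<exists>z. z \<noteq> p \<and> z \<in> T \<and> z \<in> U" using y by auto
    qed
    ultimately show "K \<inter> mtopology derived_set_of T \<noteq> {}" by (auto simp: K_def)
  qed
  moreover have "K \<subseteq> \<Union>\<V>" using BM assms(4) unfolding K_def open_cover_def by blast
  ultimately obtain \<V>' where V': "finite \<V>'" "\<V>' \<subseteq> \<V>" "K \<subseteq> \<Union>\<V>'"
    using assms(4) unfolding compactin_def open_cover_def by meson
  have "\<exists>n. B n \<subseteq> \<Union>\<V>'"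
  proof (rule ccontr)
    assume "\<not> ?thesis"
    then have "\<forall>n. \<exists>y. y \<in> B n - \<Union>\<V>'" by blast
    then obtain \<sigma> where \<sigma>: "\<And>n. \<sigma> n \<in> B n - \<Union>\<V>'" by metis
    then obtain p where p: "cluster_point \<sigma> p" using cluster by blast
    have "p \<in> B n" for n
    proof (rule cluster_point_in_closed[OF p closed])
      have "\<sigma> k \<in> B n" if "n \<le> k" for k
        using \<sigma>[of k] decseqD[OF assms(2) that] by blast
      then show "\<forall>\<^sub>F k in sequentially. \<sigma> k \<in> B n"
        by (auto simp: eventually_sequentially)
    qed
    then have "p \<in> \<Union>\<V>'" using V'(3) unfolding K_def by blast
    moreover have "openin mtopology (\<Union>\<V>')"
      using V'(2) assms(4) by (auto simp: open_cover_def)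
    ultimately have "\<exists>\<^sub>F n in sequentially. \<sigma> n \<in> \<Union>\<V>'"
      using p by (auto simp: cluster_point_def)
    then show False using \<sigma> by (auto simp: frequently_def)
  qed
  then show ?thesis using V' by blast
qed

text \<open>A set of points is locally finite when its derived set is empty, so this is the
  Bolzano-Weierstrass characterisation of compactness; being closed extends local finiteness from
  the points of \<open>S\<close> to all of \<open>M\<close>.\<close>

lemma infinite_locally_finite_subset:
  assumes "closedin mtopology S" "\<not> compactin mtopology S"
  shows "\<exists>T\<subseteq>S. infinite T \<and> (\<forall>x\<in>M. \<exists>U. openin mtopology U \<and> x \<in> U \<and> finite (T \<inter> U))"
proof -
  have "S \<subseteq> M" using closedin_subset[OF assms(1)] by simp
  then obtain T where T: "T \<subseteq> S" "infinite T" "S \<inter> mtopology derived_set_of T = {}"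
    using assms(2) unfolding compactin_eq_Bolzano_Weierstrass by blast
  have "\<exists>U. openin mtopology U \<and> x \<in> U \<and> finite (T \<inter> U)" if x: "x \<in> M" for x
  proof (cases "x \<in> S")
    case True
    then have "x \<notin> mtopology derived_set_of T" using T(3) by blast
    then obtain U where U: "x \<in> U" "openin mtopology U" "\<forall>y. y \<in> T \<longrightarrow> y \<in> U \<longrightarrow> y = x"
      using x unfolding in_derived_set_of topspace_mtopology by blast
    then have "T \<inter> U \<subseteq> {x}" by blast
    then show ?thesis using U by (meson finite.emptyI finite_insert finite_subset)
  next
    case False
    have "openin mtopology (M - S)" using assms(1) by (simp add: closedin_def)
    moreover have "T \<inter> (M - S) = {}" using T(1) by blast
    ultimately show ?thesis using False x by (intro exI[of _ "M - S"]) auto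
  qed
  then show ?thesis using T by blast
qed

section \<open>Uniform star superparacompactness\<close>

text \<open>Cutting a cover along the clopen \<open>\<mu>\<close>-components yields the refinement that the definition
  asks for, since its members meet only the component they lie in.\<close>

lemma USP_if_components_finitely_covered:
  assumes "\<And>\<V>. open_cover \<V> \<Longrightarrow>
    \<exists>\<mu>>0. \<forall>x\<in>M. \<exists>\<V>'\<subseteq>\<V>. finite \<V>' \<and> chain_component x \<mu> \<subseteq> \<Union>\<V>'"
  shows "uniformly_star_superparacompact"
  unfolding uniformly_star_superparacompact_def
proof (intro allI impI)
  fix \<V> assume V: "open_cover \<V>"
  obtain \<mu> where \<mu>: "\<mu> > 0"
    "\<forall>x\<in>M. \<exists>\<V>'\<subseteq>\<V>. finite \<V>' \<and> chain_component x \<mu> \<subseteq> \<Union>\<V>'"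
    using assms[OF V] by blast
  define F where
    "F C = (SOME \<V>'. \<V>' \<subseteq> \<V> \<and> finite \<V>' \<and> C \<subseteq> \<Union>\<V>')" for C
  \<comment> \<open>The subfamily must depend on the component as a set, not on the point representing it.\<close>
  have F: "F (chain_component x \<mu>) \<subseteq> \<V>" "finite (F (chain_component x \<mu>))"
      "chain_component x \<mu> \<subseteq> \<Union>(F (chain_component x \<mu>))" if "x \<in> M" for x
  proof -
    have "\<exists>\<V>'. \<V>' \<subseteq> \<V> \<and> finite \<V>' \<and> chain_component x \<mu> \<subseteq> \<Union>\<V>'"
      using \<mu>(2) that by blast
    from someI_ex[OF this]
    show "F (chain_component x \<mu>) \<subseteq> \<V>" "finite (F (chain_component x \<mu>))"
      "chain_component x \<mu> \<subseteq> \<Union>(F (chain_component x \<mu>))"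
      unfolding F_def by blast+
  qed
  define pieces where
    "pieces x = (\<lambda>V. chain_component x \<mu> \<inter> V) ` F (chain_component x \<mu>)" for x
  define \<U> where "\<U> = (\<Union>x\<in>M. pieces x)"
  have open_U: "openin mtopology U" if U: "U \<in> \<U>" for U
  proof -
    obtain x V where "x \<in> M" "V \<in> F (chain_component x \<mu>)" "U = chain_component x \<mu> \<inter> V"
      using U unfolding \<U>_def pieces_def by blast
    then show ?thesis
      using F(1)[of x] V openin_chain_component[OF \<mu>(1)]
      by (auto simp: open_cover_def intro!: openin_Int)
  qed
  have cover: "\<Union>\<U> = M"
  proof
    show "\<Union>\<U> \<subseteq> M" using chain_component_subset by (fastforce simp: \<U>_def pieces_def)
    show "M \<subseteq> \<Union>\<U>"
    proof
      fix x assume x: "x \<in> M"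
      then have "x \<in> \<Union>(pieces x)"
        using F(3)[OF x] chain_component_refl[OF x \<mu>(1)] unfolding pieces_def by blast
      then show "x \<in> \<Union>\<U>" using x by (auto simp: \<U>_def)
    qed
  qed
  have fin: "finite {U \<in> \<U>. chain_component x \<mu> \<inter> U \<noteq> {}}" if x: "x \<in> M" for x
  proof (rule finite_subset)
    show "finite (pieces x)" using F(2)[OF x] by (simp add: pieces_def)
    show "{U \<in> \<U>. chain_component x \<mu> \<inter> U \<noteq> {}} \<subseteq> pieces x"
    proof
      fix U assume "U \<in> {U \<in> \<U>. chain_component x \<mu> \<inter> U \<noteq> {}}"
      then obtain z where U: "U \<in> \<U>" "z \<in> chain_component x \<mu>" "z \<in> U" by blast
      then obtain w where w: "w \<in> M" "U \<in> pieces w" by (auto simp: \<U>_def)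
      then have "z \<in> chain_component w \<mu>" using U(3) by (auto simp: pieces_def)
      then have "chain_component w \<mu> = chain_component x \<mu>"
        using U(2) chain_component_eq by metis
      then have "pieces w = pieces x" by (simp add: pieces_def)
      then show "U \<in> pieces x" using w by simp
    qed
  qed
  have refine: "\<exists>V\<in>\<V>. U \<subseteq> V" if "U \<in> \<U>" for U
    using that F(1) by (fastforce simp: \<U>_def pieces_def)
  show "\<exists>\<mu>>0. \<exists>\<U>. open_cover \<U> \<and> (\<forall>U\<in>\<U>. \<exists>V\<in>\<V>. U \<subseteq> V) \<and>
           (\<forall>x\<in>M. finite {U\<in>\<U>. chain_component x \<mu> \<inter> U \<noteq> {}})"
    by (intro exI[of _ \<mu>] exI[of _ \<U>] conjI ballI \<mu>(1) refine fin)
      (simp_all add: open_cover_def open_U cover)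
qed

text \<open>The neighbourhoods that contain only finitely many of the points form an open cover, and
  each \<open>\<mu>\<close>-component is covered by finitely many of them.\<close>

lemma USP_locally_finite:
  assumes "uniformly_star_superparacompact"
    and "\<And>x. x \<in> M \<Longrightarrow> \<exists>U. openin mtopology U \<and> x \<in> U \<and> finite {i \<in> I. y i \<in> U}"
  shows "\<exists>\<mu>>0. \<forall>x\<in>M. finite {i \<in> I. y i \<in> chain_component x \<mu>}"
proof -
  define \<V> where "\<V> = {U. openin mtopology U \<and> finite {i \<in> I. y i \<in> U}}"
  have "\<Union>\<V> = M"
  proof
    show "\<Union>\<V> \<subseteq> M" using openin_subset by (fastforce simp: \<V>_def)
    show "M \<subseteq> \<Union>\<V>" using assms(2) by (fastforce simp: \<V>_def)
  qed
  then have "open_cover \<V>" by (auto simp: open_cover_def \<V>_def)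
  from assms(1)[unfolded uniformly_star_superparacompact_def, rule_format, OF this]
  obtain \<mu> \<U> where \<mu>: "\<mu> > 0" and U: "open_cover \<U>" "\<forall>U\<in>\<U>. \<exists>V\<in>\<V>. U \<subseteq> V"
    "\<forall>x\<in>M. finite {U\<in>\<U>. chain_component x \<mu> \<inter> U \<noteq> {}}"
    by (elim exE conjE)
  have "finite {i \<in> I. y i \<in> chain_component x \<mu>}" if "x \<in> M" for x
  proof (rule finite_subset)
    let ?W = "{U\<in>\<U>. chain_component x \<mu> \<inter> U \<noteq> {}}"
    have "finite {i \<in> I. y i \<in> U}" if U': "U \<in> \<U>" for U
    proof -
      obtain V where "V \<in> \<V>" "U \<subseteq> V" using U(2) U' by blast
      then have "finite {i \<in> I. y i \<in> V}" "{i \<in> I. y i \<in> U} \<subseteq> {i \<in> I. y i \<in> V}"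
        by (auto simp: \<V>_def)
      then show ?thesis by (rule rev_finite_subset)
    qed
    then show "finite (\<Union>U\<in>?W. {i \<in> I. y i \<in> U})" using U(3) that by auto
    show "{i \<in> I. y i \<in> chain_component x \<mu>} \<subseteq> (\<Union>U\<in>?W. {i \<in> I. y i \<in> U})"
    proof clarify
      fix i assume i: "i \<in> I" "y i \<in> chain_component x \<mu>"
      then have "y i \<in> \<Union>\<U>" using chain_component_subset U(1) by (auto simp: open_cover_def)
      then show "i \<in> (\<Union>U\<in>?W. {i \<in> I. y i \<in> U})" using i by auto
    qed
  qed
  then show ?thesis using \<mu> by blast
qed

text \<open>The first scale \<open>\<mu>\<close> makes the components \<open>C n\<close> of the \<open>\<sigma> n\<close> locally finite, and this is
  what allows infinite locally finite subsets \<open>Z n\<close> of the \<open>C n\<close> to be glued into a single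
  locally finite set \<open>D\<close>. The second scale \<open>\<nu>\<close> then contradicts \<open>Z n \<subseteq> D\<close> once \<open>C n\<close> lies in
  one \<open>\<nu>\<close>-component.\<close>

lemma USP_imp_cluster_point:
  assumes USP: "uniformly_star_superparacompact"
    and \<sigma>: "\<And>n. \<sigma> n \<in> noncompact_part (1 / Suc n)"
  shows "\<exists>p. cluster_point \<sigma> p"
proof (rule ccontr)
  assume no: "\<nexists>p. cluster_point \<sigma> p"
  define C where "C n = chain_component (\<sigma> n) (1 / Suc n)" for n
  have \<sigma>M: "\<sigma> n \<in> M" for n using \<sigma>[of n] by (simp add: noncompact_part_def)
  have C: "closedin mtopology (C n)" "\<not> compactin mtopology (C n)" for n
    using \<sigma>[of n] by (auto simp: C_def noncompact_part_def intro!: closedin_chain_component)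
  have C_sub: "C n \<subseteq> chain_component (\<sigma> n) \<mu>" if "1 / Suc m < \<mu>" "m \<le> n" for m n \<mu>
  proof -
    have "1 / real (Suc n) \<le> 1 / Suc m" using that(2) by (intro divide_left_mono) auto
    then show ?thesis using that(1) unfolding C_def by (intro chain_component_mono) linarith
  qed
  obtain \<mu> where \<mu>: "\<mu> > 0" "\<And>x. x \<in> M \<Longrightarrow> finite {n. \<sigma> n \<in> chain_component x \<mu>}"
    using USP_locally_finite[OF USP, of UNIV \<sigma>] not_cluster_pointD no by auto
  obtain N where N: "1 / Suc N < \<mu>"
    using nat_approx_posE[OF \<mu>(1)] by blast
  have "\<forall>n. \<exists>T\<subseteq>C n. infinite T \<and>
      (\<forall>x\<in>M. \<exists>U. openin mtopology U \<and> x \<in> U \<and> finite (T \<inter> U))"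
    using infinite_locally_finite_subset[OF C] by blast
  then obtain Z where Z: "\<And>n. Z n \<subseteq> C n" "\<And>n. infinite (Z n)"
    "\<And>n x. x \<in> M \<Longrightarrow> \<exists>U. openin mtopology U \<and> x \<in> U \<and> finite (Z n \<inter> U)"
    by metis
  define D where "D = (\<Union>n\<in>{N..}. Z n)"
  have "\<exists>U. openin mtopology U \<and> x \<in> U \<and> finite {z \<in> D. z \<in> U}" if x: "x \<in> M" for x
  proof -
    define J where "J = {n. \<sigma> n \<in> chain_component x \<mu>}"
    have J: "finite J" using \<mu>(2)[OF x] by (simp add: J_def)
    obtain W where W: "\<And>n. openin mtopology (W n)" "\<And>n. x \<in> W n" "\<And>n. finite (Z n \<inter> W n)"
      using Z(3)[OF x] by metis
    define U where "U = \<Inter>(insert (chain_component x \<mu>) (W ` J))"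
    have "openin mtopology U"
      unfolding U_def using J W(1) openin_chain_component[OF \<mu>(1)]
      by (intro openin_Inter) auto
    moreover have "x \<in> U" using W(2) chain_component_refl[OF x \<mu>(1)] by (simp add: U_def)
    moreover have "{z \<in> D. z \<in> U} \<subseteq> (\<Union>n\<in>J. Z n \<inter> W n)"
    proof clarify
      fix z assume z: "z \<in> D" "z \<in> U"
      then obtain n where n: "n \<ge> N" "z \<in> Z n" by (auto simp: D_def)
      have "z \<in> chain_component (\<sigma> n) \<mu>" using n Z(1) C_sub[OF N] by blast
      moreover have "z \<in> chain_component x \<mu>" using z by (simp add: U_def)
      ultimately have "chain_component (\<sigma> n) \<mu> = chain_component x \<mu>"
        using chain_component_eq by metis
      then have "n \<in> J"
        using chain_component_refl[OF \<sigma>M \<mu>(1)] by (auto simp: J_def)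
      then show "z \<in> (\<Union>n\<in>J. Z n \<inter> W n)" using z n by (auto simp: U_def)
    qed
    ultimately show ?thesis using J W(3) by (meson finite_UN finite_subset)
  qed
  then obtain \<nu> where \<nu>: "\<nu> > 0" "\<And>x. x \<in> M \<Longrightarrow> finite {z \<in> D. z \<in> chain_component x \<nu>}"
    using USP_locally_finite[OF USP, of D "\<lambda>z. z"] by auto
  obtain K where K: "1 / Suc K < \<nu>"
    using nat_approx_posE[OF \<nu>(1)] by blast
  define n where "n = max N K"
  have "Z n \<subseteq> {z \<in> D. z \<in> chain_component (\<sigma> n) \<nu>}"
    using Z(1)[of n] C_sub[OF K, of n] by (auto simp: D_def n_def)
  then show False using \<nu>(2)[OF \<sigma>M] Z(2) finite_subset by blast
qed

section \<open>Total boundedness by chain balls\<close>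

lemma eta_lessD:
  assumes "eta A < ennreal \<epsilon>"
  shows "\<exists>m\<ge>1. \<exists>F. finite F \<and> F \<subseteq> M \<and> A \<subseteq> (\<Union>x\<in>F. chain_ball m x \<epsilon>)"
proof -
  obtain e m F where e: "ennreal e < ennreal \<epsilon>" "e > 0" and m: "m \<ge> 1" "finite F" "F \<subseteq> M"
    "A \<subseteq> (\<Union>x\<in>F. chain_ball m x e)"
    using assms unfolding eta_def Inf_less_iff by blast
  then have "e \<le> \<epsilon>" using ennreal_less_iff[of e \<epsilon>] by (simp add: less_imp_le)
  then have "(\<Union>x\<in>F. chain_ball m x e) \<subseteq> (\<Union>x\<in>F. chain_ball m x \<epsilon>)"
    by (intro UN_mono chain_ball_mono) auto
  with m(4) have "A \<subseteq> (\<Union>x\<in>F. chain_ball m x \<epsilon>)" by (rule order_trans)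
  with m(1-3) show ?thesis by (intro exI[of _ m] exI[of _ F] conjI)
qed

lemma eta_le:
  assumes "\<epsilon> > 0" "finite F" "F \<subseteq> M" "A \<subseteq> (\<Union>x\<in>F. mball x \<epsilon>)"
  shows "eta A \<le> ennreal \<epsilon>"
proof -
  have "A \<subseteq> (\<Union>x\<in>F. chain_ball 1 x \<epsilon>)"
    using assms(4) UN_mono[OF order_refl mball_subset_chain_ball_1] by (rule order_trans)
  then have "\<exists>m\<ge>1. \<exists>F. finite F \<and> F \<subseteq> M \<and> A \<subseteq> (\<Union>x\<in>F. chain_ball m x \<epsilon>)"
    using assms(2,3) by (intro exI[of _ 1] exI[of _ F] conjI) simp_all
  then show ?thesis
    unfolding eta_def using assms(1) by (intro Inf_lower CollectI exI[of _ \<epsilon>] conjI refl)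
qed

text \<open>At each scale infinitely many terms share one chain ball; thinning out for the scales
  \<open>1 / (n + 1)\<close> in turn and taking the diagonal gives a subsequence that works for all scales.\<close>

lemma Bourbaki_Cauchy_subsequence:
  assumes \<sigma>: "\<And>n. \<sigma> n \<in> M"
    and cover: "\<And>\<epsilon>. \<epsilon> > 0 \<Longrightarrow> \<exists>m\<ge>1. \<exists>F. finite F \<and> F \<subseteq> M \<and>
      (\<forall>\<^sub>F n in sequentially. \<sigma> n \<in> (\<Union>x\<in>F. chain_ball m x \<epsilon>))"
  shows "\<exists>r. strict_mono r \<and> Bourbaki_Cauchy (\<sigma> \<circ> r)"
proof -
  define P where
    "P n s \<longleftrightarrow> (\<exists>m\<ge>1. \<exists>p\<in>M. \<forall>k. \<sigma> (s k) \<in> chain_ball m p (1 / Suc n))" for n and s :: "nat \<Rightarrow> nat"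
  interpret subseqs P
  proof
    fix n and s :: "nat \<Rightarrow> nat" assume s: "strict_mono s"
    obtain m F where m: "m \<ge> 1" "finite F" "F \<subseteq> M"
      "\<forall>\<^sub>F k in sequentially. \<sigma> k \<in> (\<Union>x\<in>F. chain_ball m x (1 / Suc n))"
      using cover[of "1 / Suc n"] by auto
    then have "\<forall>\<^sub>F k in sequentially. \<sigma> (s k) \<in> (\<Union>x\<in>F. chain_ball m x (1 / Suc n))"
      using eventually_subseq[OF s] by blast
    then obtain k0 where k0: "\<And>k. k \<ge> k0 \<Longrightarrow> \<exists>x\<in>F. \<sigma> (s k) \<in> chain_ball m x (1 / Suc n)"
      by (auto simp: eventually_sequentially)
    have "infinite {k0..}" by (rule infinite_Ici)
    moreover have "{k0..} \<subseteq> (\<Union>x\<in>F. {k. \<sigma> (s k) \<in> chain_ball m x (1 / Suc n)})"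
      using k0 by auto
    ultimately obtain p where p: "p \<in> F" "infinite {k. \<sigma> (s k) \<in> chain_ball m p (1 / Suc n)}"
      using m(2) by (meson finite_UN finite_subset)
    obtain r :: "nat \<Rightarrow> nat" where r: "strict_mono r" "\<forall>k. \<sigma> (s (r k)) \<in> chain_ball m p (1 / Suc n)"
      using infinite_enumerate[OF p(2)] unfolding mem_Collect_eq by blast
    have "P n (s \<circ> r)"
      unfolding P_def o_def
      by (intro exI[of _ m] bexI[of _ p] conjI m(1) r(2)) (use m(3) p(1) in blast)
    with r(1) show "\<exists>r. strict_mono r \<and> P n (s \<circ> r)" by blast
  qed
  have "P n (s \<circ> r)" if "P n s" for r s n using that by (fastforce simp: P_def)
  then have P: "P n (diagseq \<circ> ((+) (Suc n)))" for n by (rule diagseq_holds)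
  have "Bourbaki_Cauchy (\<sigma> \<circ> diagseq)"
    unfolding Bourbaki_Cauchy_def
  proof (intro conjI allI impI)
    show "range (\<sigma> \<circ> diagseq) \<subseteq> M" using \<sigma> by auto
    fix \<epsilon> :: real assume "\<epsilon> > 0"
    then obtain n where n: "1 / Suc n < \<epsilon>" using nat_approx_posE by blast
    obtain m p where m: "m \<ge> 1" "p \<in> M"
      "\<And>k. \<sigma> (diagseq (Suc n + k)) \<in> chain_ball m p (1 / Suc n)"
      using P[of n] by (auto simp: P_def)
    have "(\<sigma> \<circ> diagseq) k \<in> chain_ball m p \<epsilon>" if "k \<ge> Suc n" for k
      using m(3)[of "k - Suc n"] that chain_ball_mono[OF less_imp_le[OF n]] by auto
    then show "\<exists>m\<ge>1. \<exists>n0. \<exists>p\<in>M. \<forall>k\<ge>n0. (\<sigma> \<circ> diagseq) k \<in> chain_ball m p \<epsilon>"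
      using m by blast
  qed
  then show ?thesis using subseq_diagseq by blast
qed

section \<open>The equivalence\<close>

lemma decseq_noncompact_part: "decseq (\<lambda>n. noncompact_part (1 / Suc n))"
  unfolding decseq_def
  by (intro allI impI noncompact_part_mono divide_left_mono) auto

lemma eta_condition_imp_cluster_point:
  assumes "Bourbaki_complete"
    and eta_cond: "\<And>\<epsilon>::real. \<epsilon> > 0 \<Longrightarrow> \<exists>\<delta>::real. \<delta> > 0 \<and>
       (\<forall>A. A \<noteq> {} \<longrightarrow> closedin mtopology A \<longrightarrow> fc_sup A < ennreal \<delta> \<longrightarrow> eta A < ennreal \<epsilon>)"
    and \<sigma>: "\<And>n. \<sigma> n \<in> noncompact_part (1 / Suc n)"
  shows "\<exists>p. cluster_point \<sigma> p"
proof -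
  have "\<exists>m\<ge>1. \<exists>F. finite F \<and> F \<subseteq> M \<and>
      (\<forall>\<^sub>F n in sequentially. \<sigma> n \<in> (\<Union>x\<in>F. chain_ball m x \<epsilon>))" if \<epsilon>: "\<epsilon> > 0" for \<epsilon>
  proof -
    obtain \<delta> where \<delta>: "\<delta> > 0" "\<And>A. A \<noteq> {} \<Longrightarrow> closedin mtopology A \<Longrightarrow>
        fc_sup A < ennreal \<delta> \<Longrightarrow> eta A < ennreal \<epsilon>"
      using eta_cond[OF \<epsilon>] by blast
    obtain N where N: "1 / Suc N < \<delta>" using nat_approx_posE[OF \<delta>(1)] by blast
    let ?A = "noncompact_part (1 / Suc N)"
    have "fc_sup ?A \<le> ennreal (1 / Suc N)"
      unfolding fc_sup_def by (rule Sup_least) (auto intro: fc_le_if_noncompact)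
    also have "\<dots> < ennreal \<delta>" using N by (intro ennreal_lessI) (auto simp: \<delta>(1))
    finally have "fc_sup ?A < ennreal \<delta>" .
    moreover have "?A \<noteq> {}" using \<sigma>[of N] by blast
    moreover have "closedin mtopology ?A" by (rule closedin_noncompact_part) simp
    ultimately have "eta ?A < ennreal \<epsilon>" by (intro \<delta>(2))
    from eta_lessD[OF this]
    obtain m F where m: "m \<ge> 1" "finite F" "F \<subseteq> M" "?A \<subseteq> (\<Union>x\<in>F. chain_ball m x \<epsilon>)"
      by (elim exE conjE)
    have "\<sigma> n \<in> ?A" if "n \<ge> N" for n
      using \<sigma>[of n] decseqD[OF decseq_noncompact_part that] by blast
    then have "\<forall>\<^sub>F n in sequentially. \<sigma> n \<in> (\<Union>x\<in>F. chain_ball m x \<epsilon>)"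
      using m(4) unfolding eventually_sequentially by blast
    with m(1-3) show ?thesis by (intro exI[of _ m] exI[of _ F] conjI)
  qed
  moreover have "\<sigma> n \<in> M" for n using \<sigma>[of n] by (simp add: noncompact_part_def)
  ultimately obtain r where "strict_mono r" "Bourbaki_Cauchy (\<sigma> \<circ> r)"
    using Bourbaki_Cauchy_subsequence[of \<sigma>] by blast
  then show ?thesis
    using assms(1) cluster_point_subsequence unfolding Bourbaki_complete_def by blast
qed

context
  assumes cluster: "\<And>\<sigma>. (\<And>n. \<sigma> n \<in> noncompact_part (1 / Suc n)) \<Longrightarrow> \<exists>p. cluster_point \<sigma> p"
begin

lemma finite_cover_of_noncompact_part:
  assumes "open_cover \<V>"
  shows "\<exists>n \<V>'. finite \<V>' \<and> \<V>' \<subseteq> \<V> \<and> noncompact_part (1 / Suc n) \<subseteq> \<Union>\<V>'"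
proof (rule finite_cover_of_some_stage[OF _ decseq_noncompact_part _ assms])
  show "closedin mtopology (noncompact_part (1 / Suc n))" for n
    by (rule closedin_noncompact_part) simp
qed (rule cluster)

lemma cluster_point_imp_USP: "uniformly_star_superparacompact"
proof (rule USP_if_components_finitely_covered)
  fix \<V> assume V: "open_cover \<V>"
  from finite_cover_of_noncompact_part[OF this]
  obtain n \<V>' where n: "finite \<V>'" "\<V>' \<subseteq> \<V>" "noncompact_part (1 / Suc n) \<subseteq> \<Union>\<V>'"
    by (elim exE conjE)
  have "\<exists>\<V>'\<subseteq>\<V>. finite \<V>' \<and> chain_component x (1 / Suc n) \<subseteq> \<Union>\<V>'" if "x \<in> M" for x
  proof (cases "x \<in> noncompact_part (1 / Suc n)")
    case True
    then have "chain_component x (1 / Suc n) \<subseteq> \<Union>\<V>'"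
      using component_subset_noncompact_part n(3) by (meson order_trans)
    then show ?thesis using n(1,2) by (intro exI[of _ \<V>'] conjI)
  next
    case False
    then have "compactin mtopology (chain_component x (1 / Suc n))"
      using that by (simp add: noncompact_part_def)
    moreover have "chain_component x (1 / Suc n) \<subseteq> \<Union>\<V>"
      using V chain_component_subset by (simp add: open_cover_def)
    moreover have "openin mtopology V" if "V \<in> \<V>" for V
      using V that by (simp add: open_cover_def)
    ultimately obtain \<F> where "finite \<F>" "\<F> \<subseteq> \<V>" "chain_component x (1 / Suc n) \<subseteq> \<Union>\<F>"
      using compactinD[of mtopology "chain_component x (1 / Suc n)" \<V>] by metis
    then show ?thesis by (intro exI[of _ \<F>] conjI)
  qed
  then show "\<exists>\<mu>>0. \<forall>x\<in>M. \<exists>\<V>'\<subseteq>\<V>. finite \<V>' \<and> chain_component x \<mu> \<subseteq> \<Union>\<V>'"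
    by (intro exI[of _ "1 / Suc n"] conjI ballI) simp_all
qed

lemma cluster_point_imp_eta_condition:
  assumes "\<epsilon> > 0"
  shows "\<exists>\<delta>::real. \<delta> > 0 \<and>
    (\<forall>A. A \<noteq> {} \<longrightarrow> closedin mtopology A \<longrightarrow> fc_sup A < ennreal \<delta> \<longrightarrow> eta A < ennreal \<epsilon>)"
proof -
  have "open_cover ((\<lambda>x. mball x (\<epsilon> / 2)) ` M)"
    using assms by (auto simp: open_cover_def)
  from finite_cover_of_noncompact_part[OF this]
  obtain n \<V>' where n: "finite \<V>'" "\<V>' \<subseteq> (\<lambda>x. mball x (\<epsilon> / 2)) ` M"
      "noncompact_part (1 / Suc n) \<subseteq> \<Union>\<V>'"
    by (elim exE conjE)
  then obtain F where F: "F \<subseteq> M" "finite F" "\<V>' = (\<lambda>x. mball x (\<epsilon> / 2)) ` F"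
    by (meson finite_subset_image)
  have "eta A < ennreal \<epsilon>" if A: "closedin mtopology A" "fc_sup A < ennreal (1 / Suc n)" for A
  proof -
    have "x \<in> noncompact_part (1 / Suc n)" if "x \<in> A" for x
    proof (rule noncompact_if_fc_less)
      show "x \<in> M" using closedin_subset[OF A(1)] that by auto
      have "fc x \<le> fc_sup A" unfolding fc_sup_def using that by (intro Sup_upper) auto
      then show "fc x < ennreal (1 / Suc n)" using A(2) by (rule le_less_trans)
    qed simp
    then have "eta A \<le> ennreal (\<epsilon> / 2)"
      using n(3) F assms by (intro eta_le[of _ F]) auto
    also have "\<dots> < ennreal \<epsilon>" using assms by (intro ennreal_lessI) auto
    finally show ?thesis .
  qed
  then show ?thesis by (intro exI[of _ "1 / Suc n"]) auto
qed

end

end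

theorem mainTheorem7:
  fixes M :: "'a set" and d :: "'a \<Rightarrow> 'a \<Rightarrow> real"
  assumes "Metric_space M d"
    and "\<exists>x\<in>M. \<exists>y\<in>M. x \<noteq> y"
    and "Metric_space.Bourbaki_complete M d"
  shows "Metric_space.uniformly_star_superparacompact M d \<longleftrightarrow>
    (\<forall>\<epsilon>::real. \<epsilon> > 0 \<longrightarrow> (\<exists>\<delta>::real. \<delta> > 0 \<and>
       (\<forall>A. A \<noteq> {} \<longrightarrow> closedin (Metric_space.mtopology M d) A \<longrightarrow>
          Metric_space.fc_sup M d A < ennreal \<delta> \<longrightarrow> Metric_space.eta M d A < ennreal \<epsilon>)))"
proof -
  interpret Metric_space M d by fact
  show ?thesis
  proof
    assume "uniformly_star_superparacompact"
    then have "\<exists>p. cluster_point \<sigma> p"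
      if "\<And>n. \<sigma> n \<in> noncompact_part (1 / Suc n)" for \<sigma>
      using that USP_imp_cluster_point by blast
    then show "\<forall>\<epsilon>::real. \<epsilon> > 0 \<longrightarrow> (\<exists>\<delta>::real. \<delta> > 0 \<and>
       (\<forall>A. A \<noteq> {} \<longrightarrow> closedin mtopology A \<longrightarrow> fc_sup A < ennreal \<delta> \<longrightarrow> eta A < ennreal \<epsilon>))"
      using cluster_point_imp_eta_condition by simp
  next
    assume "\<forall>\<epsilon>::real. \<epsilon> > 0 \<longrightarrow> (\<exists>\<delta>::real. \<delta> > 0 \<and>
       (\<forall>A. A \<noteq> {} \<longrightarrow> closedin mtopology A \<longrightarrow> fc_sup A < ennreal \<delta> \<longrightarrow> eta A < ennreal \<epsilon>))"
    then have "\<exists>p. cluster_point \<sigma> p"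
      if "\<And>n. \<sigma> n \<in> noncompact_part (1 / Suc n)" for \<sigma>
      using that eta_condition_imp_cluster_point[OF assms(3)] by blast
    then show "uniformly_star_superparacompact"
      by (rule cluster_point_imp_USP)
  qed
qed

end
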